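(* For $F\in\mathrm{Conf}(T\mathcal B,T\mathcal E)$ let $\mathfrak G=F^*\mathfrak g$, $\Gamma=F^*\gamma$, $\Theta=F^*\vartheta$, $\mathbf G=\bar F^*\mathbf g$ and let $\mathfrak G_v^v$ be the restriction of $\mathfrak G$ to $V\mathcal B$. Then the data of $\mathfrak G$ is equivalent to the joint data of the micro-metric $\mathfrak G_v^v$ and of the connection $\Gamma-\Theta:\mathcal B\times_{\mathbb B}T\mathbb B\to T\mathcal B$; that is, for any $F,F'\in\mathrm{Conf}(T\mathcal B,T\mathcal E)$ with associated objects $(\mathfrak G,\Gamma,\Theta)$ and $(\mathfrak G',\Gamma',\Theta')$, $$\mathfrak G=\mathfrak G'\iff\big(\mathfrak G_v^v={\mathfrak G'}_v^v\ \text{ and }\ \Gamma-\Theta=\Gamma'-\Theta'\big).$$ Furthermore, for every such $F$, $$\mathbf G=\Theta^\star\cdot\mathfrak G_v^v\cdot\Theta,$$ i.e. $\langle\bar U,\bar W\rangle_{\mathbf G}=\langle\Theta_X\bar U,\Theta_X\bar W\rangle_{\mathfrak G}$ for all $X\in\mathcal B$ and $\bar U,\bar W\in T_{\pi_{\mathcal B}(X)}\mathbb B$. In particular, if $\dim\mathbb B$ equals the rank of $\mathcal B$ and $\Theta$ is known, the data of $\mathfrak G_v^v$ is equivalent to the data of $\mathbf G$: if $\Theta=\Theta'$ then $\mathfrak G_v^v={\mathfrak G'}_v^v\iff\mathbf G=\mathbf G'$.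
   Context: Smooth means at least $C^1$. Affine bundles. An affine bundle $\pi_{A}:A\to\mathbb A$ is a smooth surjection between smooth connected orientable manifolds which is locally trivial with typical fibre a finite-dimensional real affine space $F_A$, with transition maps affine on the fibres; its rank is $\dim F_A$. Affine trivialising coordinates are local coordinates $(\bar x,y)$ on $A$ with $\bar x$ coordinates on $\mathbb A$ and $y$ affine coordinates on each fibre; they induce coordinates $(\bar x,y,\delta\bar x,\delta y)$ on $TA$ ("vectorial coordinates" $(\delta \bar x,\delta y)$). $VA=\ker T\pi_A\subset TA$. Ambient space. $\mathbb E=\mathbb R^3$ with Euclidean metric $\mathbf g$; $\mathcal E=\mathbb R^3\times\mathbb R^3\ni(\bar x,y)$ with $\pi_{\mathcal E}(\bar x,y)=\bar x$. In the canonical coordinates, the connection is $\gamma_{(\bar x,y)}(\delta\bar x)=((\bar x,y),(\delta\bar x,0))$, the solder form is $\vartheta_{(\bar x,y)}(\delta\bar x)=((\bar x,y),(0,\delta\bar x))$, and the pseudo-metric is $\mathfrak g=\iota^*\mathbf g$ with $\iota:T\mathcal E\to T\mathbb E$, $((\bar x,y),(\delta\bar x,\delta y))\mapsto(\bar x,\delta\bar x+\delta y)$. Material bundle. $\pi_{\mathcal B}:\mathcal B\to\mathbb B$ is an affine bundle of rank $3$, $\dim\mathbb B\in\{1,2,3\}$. Placements. For affine bundles $A\to\mathbb A$, $D\to\mathbb D$, $\mathrm{Aff}(A,D)$ is the set of smooth maps $\ell:A\to D$ such that there is a smooth $\bar\ell:\mathbb A\to\mathbb D$ with $\pi_D\circ\ell=\bar\ell\circ\pi_A$,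 and $\ell$ is affine on each fibre. A smooth map $L:TA\to TD$ is physically acceptable, $L\in\mathcal L_{pa}(TA,TD)$, if: (1) $L$ is a vector bundle morphism $TA\to TD$ over some $\ell\in\mathrm{Aff}(A,D)$ (its punctual shadow); (2) $T\pi_D\circ L=\bar L\circ T\pi_A$ with $\bar L:=T\bar\ell$; (3) $L|_{VA}=(T\ell)|_{VA}$; (4) in affine trivialising coordinates, the vectorial coordinates of $L_a u$ (for fixed vectorial coordinates of $u\in T_aA$) are affine in the vertical coordinate $y$ of $a$. $\mathrm{Conf}(T\mathcal B,T\mathcal E)$ is the set of $F\in\mathcal L_{pa}(T\mathcal B,T\mathcal E)$ that are differential embeddings and whose punctual shadow $\varphi:\mathcal B\to\mathcal E$ is a differential embedding. Pull-backs. For such $F$: $(F^*\gamma)_X=F_X^{-1}\circ\gamma_{\varphi(X)}\circ\bar F$ and $(F^*\vartheta)_X=F_X^{-1}\circ\vartheta_{\varphi(X)}\circ\bar F$ for $X\in\mathcal B$ (maps $T_{\bar X}\mathbb B\to T_X\mathcal B$); $\langle U,W\rangle_{F^*\mathfrak g}=\langle FU,FW\rangle_{\mathfrak g}$ on $T\mathcal B$; $\langle\bar U,\bar W\rangle_{\bar F^*\mathbf g}=\langle\bar F\bar U,\bar F\bar W\rangle_{\mathbf g}$ on $T\mathbb B$. *)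

theory Defs
  imports "HOL-Analysis.Analysis" "HOL-Library.Extended_Nat"
begin

section \<open>Maps of class $C^k$ on open sets, affine maps, determinants\<close>

primrec n_smooth_on ::
  "nat \<Rightarrow> ('a::euclidean_space \<Rightarrow> 'b::euclidean_space) \<Rightarrow> 'a set \<Rightarrow> bool" where
  "n_smooth_on 0 f S \<longleftrightarrow> continuous_on S f"
| "n_smooth_on (Suc n) f S \<longleftrightarrow>
     (\<forall>x\<in>S. f differentiable (at x)) \<and>
     (\<forall>v. n_smooth_on n (\<lambda>x. frechet_derivative f (at x) v) S)"

text \<open>Only meant for open \<open>S\<close>; \<open>k = \<infinity>\<close> is allowed.\<close>

definition smooth_on ::
  "enat \<Rightarrow> ('a::euclidean_space \<Rightarrow> 'b::euclidean_space) \<Rightarrow> 'a set \<Rightarrow> bool" where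
  "smooth_on k f S \<longleftrightarrow> (\<forall>n. enat n \<le> k \<longrightarrow> n_smooth_on n f S)"

definition affine_map :: "('a::real_vector \<Rightarrow> 'b::real_vector) \<Rightarrow> bool" where
  "affine_map h \<longleftrightarrow> linear (\<lambda>y. h y - h 0)"

definition endo_det :: "('e::euclidean_space \<Rightarrow> 'e) \<Rightarrow> real" where
  "endo_det f = (\<Sum>p | p permutes (Basis :: 'e set).
      of_int (sign p) * (\<Prod>b\<in>Basis. f b \<bullet> p b))"


section \<open>Manifolds\<close>

text \<open>
  A manifold is given by an atlas, whose charts \<open>(U, f)\<close> have a domain \<open>U\<close> in the point type
  and take values in a Euclidean model space; only the values of \<open>f\<close> on \<open>U\<close> matter. No topology
  is assumed on the point type: the manifold topology is the one that makes all the charts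
  homeomorphisms onto open sets.
\<close>

type_synonym ('a, 'e) chart = "'a set \<times> ('a \<Rightarrow> 'e)"

definition chart_inv :: "('a, 'e) chart \<Rightarrow> 'e \<Rightarrow> 'a" where
  "chart_inv c = inv_into (fst c) (snd c)"

definition is_chart :: "('a, 'e::euclidean_space) chart \<Rightarrow> bool" where
  "is_chart c \<longleftrightarrow> inj_on (snd c) (fst c) \<and> open (snd c ` fst c)"

definition chart_compatible ::
  "enat \<Rightarrow> ('a, 'e::euclidean_space) chart \<Rightarrow> ('a, 'e) chart \<Rightarrow> bool" where
  "chart_compatible k c d \<longleftrightarrow>
     open (snd c ` (fst c \<inter> fst d)) \<and> open (snd d ` (fst c \<inter> fst d)) \<and>
     smooth_on k (snd d \<circ> chart_inv c) (snd c ` (fst c \<inter> fst d)) \<and>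
     smooth_on k (snd c \<circ> chart_inv d) (snd d ` (fst c \<inter> fst d))"

definition atlas :: "enat \<Rightarrow> ('a, 'e::euclidean_space) chart set \<Rightarrow> bool" where
  "atlas k M \<longleftrightarrow> (\<forall>c\<in>M. is_chart c) \<and> (\<forall>c\<in>M. \<forall>d\<in>M. chart_compatible k c d)"

definition points :: "('a, 'e) chart set \<Rightarrow> 'a set" where
  "points M = (\<Union>c\<in>M. fst c)"

definition manifold_topology :: "('a, 'e::euclidean_space) chart set \<Rightarrow> 'a topology" where
  "manifold_topology M =
     topology (\<lambda>W. W \<subseteq> points M \<and> (\<forall>c\<in>M. open (snd c ` (W \<inter> fst c))))"

lemma openin_manifold_topology:
  assumes "\<And>c. c \<in> M \<Longrightarrow> is_chart c"
  shows "openin (manifold_topology M) W \<longleftrightarrow>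
    W \<subseteq> points M \<and> (\<forall>c\<in>M. open (snd c ` (W \<inter> fst c)))"
proof -
  have "istopology (\<lambda>W. W \<subseteq> points M \<and> (\<forall>c\<in>M. open (snd c ` (W \<inter> fst c))))"
    unfolding istopology_def
  proof (intro conjI allI impI ballI)
    fix S T c assume S: "S \<subseteq> points M \<and> (\<forall>c\<in>M. open (snd c ` (S \<inter> fst c)))"
      and T: "T \<subseteq> points M \<and> (\<forall>c\<in>M. open (snd c ` (T \<inter> fst c)))" and c: "c \<in> M"
    have "snd c ` (S \<inter> T \<inter> fst c) = snd c ` (S \<inter> fst c) \<inter> snd c ` (T \<inter> fst c)"
      using assms[OF c] by (auto simp: is_chart_def inj_on_def)
    then show "open (snd c ` (S \<inter> T \<inter> fst c))"
      using S T c by (simp add: open_Int)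
  next
    fix K c assume K: "\<forall>W\<in>K. W \<subseteq> points M \<and> (\<forall>c\<in>M. open (snd c ` (W \<inter> fst c)))"
      and c: "c \<in> M"
    have "snd c ` (\<Union>K \<inter> fst c) = (\<Union>W\<in>K. snd c ` (W \<inter> fst c))" by blast
    then show "open (snd c ` (\<Union>K \<inter> fst c))" using K c by auto
  qed auto
  then show ?thesis
    by (simp add: manifold_topology_def topology_inverse')
qed

definition orientable :: "enat \<Rightarrow> ('a, 'e::euclidean_space) chart set \<Rightarrow> bool" where
  "orientable k M \<longleftrightarrow>
     (\<exists>N. atlas k N \<and> points N = points M \<and> (\<forall>c\<in>M. \<forall>d\<in>N. chart_compatible k c d) \<and>
       (\<forall>c\<in>N. \<forall>d\<in>N. \<forall>x \<in> snd c ` (fst c \<inter> fst d).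
          endo_det (frechet_derivative (snd d \<circ> chart_inv c) (at x)) > 0))"

text \<open>Smooth connected orientable manifolds.\<close>

definition manifold :: "enat \<Rightarrow> ('a, 'e::euclidean_space) chart set \<Rightarrow> bool" where
  "manifold k M \<longleftrightarrow>
     atlas k M \<and> Hausdorff_space (manifold_topology M) \<and>
     second_countable (manifold_topology M) \<and>
     connected_space (manifold_topology M) \<and> orientable k M"

definition smooth_map ::
  "enat \<Rightarrow> ('a, 'e::euclidean_space) chart set \<Rightarrow> ('b, 'f::euclidean_space) chart set
     \<Rightarrow> ('a \<Rightarrow> 'b) \<Rightarrow> bool" where
  "smooth_map k M N f \<longleftrightarrow>
     f ` points M \<subseteq> points N \<and>
     (\<forall>c\<in>M. \<forall>d\<in>N. open (snd c ` (fst c \<inter> f -` fst d)) \<and>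
        smooth_on k (snd d \<circ> f \<circ> chart_inv c) (snd c ` (fst c \<inter> f -` fst d)))"


section \<open>Tangent bundles\<close>

text \<open>
  A tangent vector at \<open>p\<close> is the family of its components in the charts of the atlas around \<open>p\<close>
  (and \<open>0\<close> for all other charts), so that the vector space operations are pointwise.
  Points of the tangent bundle are pairs of a base point and a tangent vector. If the
  atlas is of class $C^{k+1}$, the induced atlas of the tangent bundle is of class $C^k$.
\<close>

type_synonym ('a, 'e) tvec = "('a, 'e) chart \<Rightarrow> 'e"

definition tangent_space ::
  "('a, 'e::euclidean_space) chart set \<Rightarrow> 'a \<Rightarrow> ('a, 'e) tvec set" where
  "tangent_space M p =
     {v. (\<forall>c\<in>M. \<forall>d\<in>M. p \<in> fst c \<inter> fst d \<longrightarrow>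
            v d = frechet_derivative (snd d \<circ> chart_inv c) (at (snd c p)) (v c)) \<and>
         (\<forall>c. \<not> (c \<in> M \<and> p \<in> fst c) \<longrightarrow> v c = 0)}"

definition tangent_chart ::
  "('a, 'e::euclidean_space) chart set \<Rightarrow> ('a, 'e) chart
     \<Rightarrow> ('a \<times> ('a, 'e) tvec, 'e \<times> 'e) chart" where
  "tangent_chart M c =
     ({(p, v). p \<in> fst c \<and> v \<in> tangent_space M p}, \<lambda>(p, v). (snd c p, v c))"

definition tangent_bundle ::
  "('a, 'e::euclidean_space) chart set \<Rightarrow> ('a \<times> ('a, 'e) tvec, 'e \<times> 'e) chart set" where
  "tangent_bundle M = tangent_chart M ` M"

definition chart_at :: "('a, 'e) chart set \<Rightarrow> 'a \<Rightarrow> ('a, 'e) chart" where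
  "chart_at M p = (SOME c. c \<in> M \<and> p \<in> fst c)"

definition tangent_map ::
  "('a, 'e::euclidean_space) chart set \<Rightarrow> ('b, 'f::euclidean_space) chart set
     \<Rightarrow> ('a \<Rightarrow> 'b) \<Rightarrow> 'a \<times> ('a, 'e) tvec \<Rightarrow> 'b \<times> ('b, 'f) tvec" where
  "tangent_map M N f = (\<lambda>(p, v).
     (f p, \<lambda>d. if d \<in> N \<and> f p \<in> fst d
               then frechet_derivative (snd d \<circ> f \<circ> chart_inv (chart_at M p))
                      (at (snd (chart_at M p) p)) (v (chart_at M p))
               else 0))"

text \<open>Components of a tangent vector in a compatible chart \<open>x\<close> that need not belong to the atlas.\<close>

definition vec_coord ::
  "('a, 'e::euclidean_space) chart set \<Rightarrow> ('a, 'e) chart \<Rightarrow> 'a \<times> ('a, 'e) tvec \<Rightarrow> 'e" where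
  "vec_coord M x = (\<lambda>(p, v).
     frechet_derivative (snd x \<circ> chart_inv (chart_at M p))
       (at (snd (chart_at M p) p)) (v (chart_at M p)))"

definition differential_embedding ::
  "enat \<Rightarrow> ('a, 'e::euclidean_space) chart set \<Rightarrow> ('b, 'f::euclidean_space) chart set
     \<Rightarrow> ('a \<Rightarrow> 'b) \<Rightarrow> bool" where
  "differential_embedding k M N f \<longleftrightarrow>
     smooth_map k M N f \<and>
     (\<forall>p\<in>points M. inj_on (\<lambda>v. snd (tangent_map M N f (p, v))) (tangent_space M p)) \<and>
     embedding_map (manifold_topology M) (manifold_topology N) f"


section \<open>Affine bundles\<close>

text \<open>
  The typical fibre is the vector space \<open>'f\<close> seen as an affine space, and the total space is
  modelled on \<open>'m \<times> 'f\<close>. A trivialisation over \<open>U\<close> is a pair \<open>(U, \<psi>)\<close>, where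
  \<open>a \<mapsto> (proj a, \<psi> a)\<close> is the diffeomorphism from the part of the total space above \<open>U\<close> to
  \<open>U \<times> 'f\<close>.
\<close>

record ('a, 'b, 'm, 'f) fibration =
  total :: "('a, 'm \<times> 'f) chart set"
  base :: "('b, 'm) chart set"
  proj :: "'a \<Rightarrow> 'b"
  trivs :: "('b set \<times> ('a \<Rightarrow> 'f)) set"

definition fibre :: "('a, 'b, 'm, 'f) fibration \<Rightarrow> 'b \<Rightarrow> 'a set" where
  "fibre A x = {a \<in> points (total A). proj A a = x}"

text \<open>Affine trivialising coordinates, from a trivialisation and a chart of the base.\<close>

definition aff_chart ::
  "('a, 'b, 'm, 'f) fibration \<Rightarrow> 'b set \<times> ('a \<Rightarrow> 'f) \<Rightarrow> ('b, 'm) chart \<Rightarrow> ('a, 'm \<times> 'f) chart" where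
  "aff_chart A t c =
     ({a \<in> points (total A). proj A a \<in> fst t \<inter> fst c}, \<lambda>a. (snd c (proj A a), snd t a))"

definition affine_bundle ::
  "enat \<Rightarrow> ('a, 'b, 'm::euclidean_space, 'f::euclidean_space) fibration \<Rightarrow> bool" where
  "affine_bundle k A \<longleftrightarrow>
     manifold k (total A) \<and> manifold k (base A) \<and>
     smooth_map k (total A) (base A) (proj A) \<and>
     proj A ` points (total A) = points (base A) \<and>
     points (base A) = (\<Union>t\<in>trivs A. fst t) \<and>
     (\<forall>t\<in>trivs A. openin (manifold_topology (base A)) (fst t)) \<and>
     (\<forall>t\<in>trivs A. \<forall>c\<in>base A.
        is_chart (aff_chart A t c) \<and>
        snd (aff_chart A t c) ` fst (aff_chart A t c) = snd c ` (fst t \<inter> fst c) \<times> UNIV \<and>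
        (\<forall>e\<in>total A. chart_compatible k (aff_chart A t c) e)) \<and>
     (\<forall>s\<in>trivs A. \<forall>t\<in>trivs A. \<forall>x \<in> fst s \<inter> fst t.
        \<exists>h. affine_map h \<and> (\<forall>a\<in>fibre A x. snd t a = h (snd s a)))"

definition vertical ::
  "('a, 'b, 'm::euclidean_space, 'f::euclidean_space) fibration
     \<Rightarrow> 'a \<Rightarrow> ('a, 'm \<times> 'f) tvec set" where
  "vertical A a =
     {u \<in> tangent_space (total A) a.
        snd (tangent_map (total A) (base A) (proj A) (a, u)) = (\<lambda>_. 0)}"

definition Aff ::
  "enat \<Rightarrow> ('a, 'b, 'm::euclidean_space, 'f::euclidean_space) fibration
     \<Rightarrow> ('c, 'd, 'n::euclidean_space, 'g::euclidean_space) fibration \<Rightarrow> ('a \<Rightarrow> 'c) set" where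
  "Aff k A D =
     {l. smooth_map k (total A) (total D) l \<and>
         (\<exists>lb. smooth_map k (base A) (base D) lb \<and>
            (\<forall>a\<in>points (total A). proj D (l a) = lb (proj A a)) \<and>
            (\<forall>s\<in>trivs A. \<forall>t\<in>trivs D. \<forall>x\<in>fst s. lb x \<in> fst t \<longrightarrow>
               (\<exists>h. affine_map h \<and> (\<forall>a\<in>fibre A x. snd t (l a) = h (snd s a)))))}"

text \<open>
  For \<open>l\<close> in \<open>Aff k A D\<close>, the map between the bases that \<open>l\<close> covers; it is unique on the points
  of the base of \<open>A\<close> because the projection is surjective.
\<close>

definition base_map ::
  "('a, 'b, 'm, 'f) fibration \<Rightarrow> ('c, 'd, 'n, 'g) fibration \<Rightarrow> ('a \<Rightarrow> 'c) \<Rightarrow> 'b \<Rightarrow> 'd" where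
  "base_map A D l x = proj D (l (SOME a. a \<in> fibre A x))"

text \<open>
  Physically acceptable maps. In the last clause \<open>x\<close> is the base point of the fibre and \<open>w\<close> are
  the fixed vectorial coordinates.
\<close>

definition L_pa ::
  "enat \<Rightarrow> ('a, 'b, 'm::euclidean_space, 'f::euclidean_space) fibration
     \<Rightarrow> ('c, 'd, 'n::euclidean_space, 'g::euclidean_space) fibration
     \<Rightarrow> ('a \<times> ('a, 'm \<times> 'f) tvec \<Rightarrow> 'c \<times> ('c, 'n \<times> 'g) tvec) set" where
  "L_pa k A D =
     {L. smooth_map k (tangent_bundle (total A)) (tangent_bundle (total D)) L \<and>
         (\<exists>l\<in>Aff k A D.
            (\<forall>a\<in>points (total A). \<forall>u\<in>tangent_space (total A) a. fst (L (a, u)) = l a) \<and>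
            (\<forall>a\<in>points (total A). \<forall>u\<in>tangent_space (total A) a.
               \<forall>v\<in>tangent_space (total A) a. \<forall>r s.
               snd (L (a, \<lambda>c. r *\<^sub>R u c + s *\<^sub>R v c)) =
                 (\<lambda>d. r *\<^sub>R snd (L (a, u)) d + s *\<^sub>R snd (L (a, v)) d)) \<and>
            (\<forall>a\<in>points (total A). \<forall>u\<in>tangent_space (total A) a.
               tangent_map (total D) (base D) (proj D) (L (a, u)) =
               tangent_map (base A) (base D) (base_map A D l)
                 (tangent_map (total A) (base A) (proj A) (a, u))) \<and>
            (\<forall>a\<in>points (total A). \<forall>u\<in>vertical A a.
               L (a, u) = tangent_map (total A) (total D) l (a, u)) \<and>
            (\<forall>s\<in>trivs A. \<forall>c\<in>base A. \<forall>t\<in>trivs D. \<forall>d\<in>base D.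
               \<forall>x \<in> fst s \<inter> fst c. base_map A D l x \<in> fst t \<inter> fst d \<longrightarrow>
               (\<forall>w. \<exists>h. affine_map h \<and>
                  (\<forall>a\<in>fibre A x. \<forall>u\<in>tangent_space (total A) a.
                     vec_coord (total A) (aff_chart A s c) (a, u) = w \<longrightarrow>
                     vec_coord (total D) (aff_chart D t d) (L (a, u)) = h (snd s a)))))}"

text \<open>The punctual shadow of a vector bundle morphism, and the induced map of tangent bundles of
  the bases.\<close>

definition shadow :: "('a \<times> ('a, 'e::zero) tvec \<Rightarrow> 'c \<times> ('c, 'g) tvec) \<Rightarrow> 'a \<Rightarrow> 'c" where
  "shadow L a = fst (L (a, \<lambda>_. 0))"

definition base_tangent ::
  "('a, 'b, 'm::euclidean_space, 'f::euclidean_space) fibration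
     \<Rightarrow> ('c, 'd, 'n::euclidean_space, 'g::euclidean_space) fibration
     \<Rightarrow> ('a \<times> ('a, 'm \<times> 'f) tvec \<Rightarrow> 'c \<times> ('c, 'n \<times> 'g) tvec)
     \<Rightarrow> 'b \<times> ('b, 'm) tvec \<Rightarrow> 'd \<times> ('d, 'n) tvec" where
  "base_tangent A D L = tangent_map (base A) (base D) (base_map A D (shadow L))"

definition Conf ::
  "enat \<Rightarrow> ('a, 'b, 'm::euclidean_space, 'f::euclidean_space) fibration
     \<Rightarrow> ('c, 'd, 'n::euclidean_space, 'g::euclidean_space) fibration
     \<Rightarrow> ('a \<times> ('a, 'm \<times> 'f) tvec \<Rightarrow> 'c \<times> ('c, 'n \<times> 'g) tvec) set" where
  "Conf k A D =
     {F \<in> L_pa k A D.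
        differential_embedding k (tangent_bundle (total A)) (tangent_bundle (total D)) F \<and>
        differential_embedding k (total A) (total D) (shadow F)}"


section \<open>The ambient space\<close>

definition eucl_chart :: "('e, 'e) chart" where
  "eucl_chart = (UNIV, id)"

definition eucl_vec :: "'e::euclidean_space \<Rightarrow> ('e, 'e) tvec" where
  "eucl_vec w = (\<lambda>c. if c = eucl_chart then w else 0)"

type_synonym space = "real ^ 3"

definition ambient :: "(space \<times> space, space, space, space) fibration" where
  "ambient = \<lparr>total = {eucl_chart}, base = {eucl_chart}, proj = fst, trivs = {(UNIV, snd)}\<rparr>"

definition space_connection ::
  "space \<times> space \<Rightarrow> (space, space) tvec \<Rightarrow> (space \<times> space, space \<times> space) tvec" where
  "space_connection e u = eucl_vec (u eucl_chart, 0)"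

definition space_solder ::
  "space \<times> space \<Rightarrow> (space, space) tvec \<Rightarrow> (space \<times> space, space \<times> space) tvec" where
  "space_solder e u = eucl_vec (0, u eucl_chart)"

definition space_metric ::
  "space \<times> (space, space) tvec \<Rightarrow> space \<times> (space, space) tvec \<Rightarrow> real" where
  "space_metric U W = snd U eucl_chart \<bullet> snd W eucl_chart"

definition iota ::
  "(space \<times> space) \<times> (space \<times> space, space \<times> space) tvec \<Rightarrow> space \<times> (space, space) tvec" where
  "iota = (\<lambda>((x, y), u). (x, eucl_vec (fst (u eucl_chart) + snd (u eucl_chart))))"

definition space_pseudo_metric ::
  "(space \<times> space) \<times> (space \<times> space, space \<times> space) tvec
     \<Rightarrow> (space \<times> space) \<times> (space \<times> space, space \<times> space) tvec \<Rightarrow> real" where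
  "space_pseudo_metric U W = space_metric (iota U) (iota W)"


section \<open>Pull-backs to the material bundle\<close>

type_synonym ('a, 'm, 'f) placement =
  "'a \<times> ('a, 'm \<times> 'f) tvec \<Rightarrow> (space \<times> space) \<times> (space \<times> space, space \<times> space) tvec"

text \<open>
  Pull-back of a connection or solder form \<open>\<kappa>\<close>: \<open>(F\<^sup>*\<kappa>)_X = F_X\<inverse> \<circ> \<kappa>_\<phi>(X) \<circ> Fbar\<close>,
  with \<open>F_X\<inverse>\<close> the inverse of the restriction of \<open>F\<close> to the tangent space at \<open>X\<close>.
\<close>

definition pull_form ::
  "('a, 'b, 'm::euclidean_space, 'f::euclidean_space) fibration \<Rightarrow> ('a, 'm, 'f) placement
     \<Rightarrow> (space \<times> space \<Rightarrow> (space, space) tvec \<Rightarrow> (space \<times> space, space \<times> space) tvec)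
     \<Rightarrow> 'a \<Rightarrow> ('b, 'm) tvec \<Rightarrow> ('a, 'm \<times> 'f) tvec" where
  "pull_form B F \<kappa> X U =
     inv_into (tangent_space (total B) X) (\<lambda>u. snd (F (X, u)))
       (\<kappa> (shadow F X) (snd (base_tangent B ambient F (proj B X, U))))"

definition pull_connection ::
  "('a, 'b, 'm::euclidean_space, 'f::euclidean_space) fibration \<Rightarrow> ('a, 'm, 'f) placement
     \<Rightarrow> 'a \<Rightarrow> ('b, 'm) tvec \<Rightarrow> ('a, 'm \<times> 'f) tvec" where
  "pull_connection B F = pull_form B F space_connection"

definition pull_solder ::
  "('a, 'b, 'm::euclidean_space, 'f::euclidean_space) fibration \<Rightarrow> ('a, 'm, 'f) placement
     \<Rightarrow> 'a \<Rightarrow> ('b, 'm) tvec \<Rightarrow> ('a, 'm \<times> 'f) tvec" where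
  "pull_solder B F = pull_form B F space_solder"

definition pull_pseudo_metric ::
  "('a, 'm, 'f) placement \<Rightarrow> 'a \<Rightarrow> ('a, 'm \<times> 'f) tvec \<Rightarrow> ('a, 'm \<times> 'f) tvec \<Rightarrow> real" where
  "pull_pseudo_metric F X U W = space_pseudo_metric (F (X, U)) (F (X, W))"

definition pull_base_metric ::
  "('a, 'b, 'm::euclidean_space, 'f::euclidean_space) fibration \<Rightarrow> ('a, 'm, 'f) placement
     \<Rightarrow> 'b \<Rightarrow> ('b, 'm) tvec \<Rightarrow> ('b, 'm) tvec \<Rightarrow> real" where
  "pull_base_metric B F x U W =
     space_metric (base_tangent B ambient F (x, U)) (base_tangent B ambient F (x, W))"

text \<open>Equality of the objects attached to two placements: \<open>\<GG> = \<GG>'\<close>, \<open>\<GG>\<^sub>v\<^sup>v = \<GG>'\<^sub>v\<^sup>v\<close>, \<open>\<Gamma> - \<Theta> = \<Gamma>' - \<Theta>'\<close>, \<open>\<Theta> = \<Theta>'\<close>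
  and \<open>G = G'\<close>, each on the domain of the objects compared.\<close>

definition same_pseudo_metric ::
  "('a, 'b, 'm::euclidean_space, 'f::euclidean_space) fibration
     \<Rightarrow> ('a, 'm, 'f) placement \<Rightarrow> ('a, 'm, 'f) placement \<Rightarrow> bool" where
  "same_pseudo_metric B F F' \<longleftrightarrow>
     (\<forall>X\<in>points (total B). \<forall>U\<in>tangent_space (total B) X. \<forall>W\<in>tangent_space (total B) X.
        pull_pseudo_metric F X U W = pull_pseudo_metric F' X U W)"

definition same_micro_metric ::
  "('a, 'b, 'm::euclidean_space, 'f::euclidean_space) fibration
     \<Rightarrow> ('a, 'm, 'f) placement \<Rightarrow> ('a, 'm, 'f) placement \<Rightarrow> bool" where
  "same_micro_metric B F F' \<longleftrightarrow>
     (\<forall>X\<in>points (total B). \<forall>U\<in>vertical B X. \<forall>W\<in>vertical B X.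
        pull_pseudo_metric F X U W = pull_pseudo_metric F' X U W)"

definition same_difference ::
  "('a, 'b, 'm::euclidean_space, 'f::euclidean_space) fibration
     \<Rightarrow> ('a, 'm, 'f) placement \<Rightarrow> ('a, 'm, 'f) placement \<Rightarrow> bool" where
  "same_difference B F F' \<longleftrightarrow>
     (\<forall>X\<in>points (total B). \<forall>U\<in>tangent_space (base B) (proj B X). \<forall>c.
        pull_connection B F X U c - pull_solder B F X U c =
        pull_connection B F' X U c - pull_solder B F' X U c)"

definition same_solder ::
  "('a, 'b, 'm::euclidean_space, 'f::euclidean_space) fibration
     \<Rightarrow> ('a, 'm, 'f) placement \<Rightarrow> ('a, 'm, 'f) placement \<Rightarrow> bool" where
  "same_solder B F F' \<longleftrightarrow>
     (\<forall>X\<in>points (total B). \<forall>U\<in>tangent_space (base B) (proj B X).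
        pull_solder B F X U = pull_solder B F' X U)"

definition same_base_metric ::
  "('a, 'b, 'm::euclidean_space, 'f::euclidean_space) fibration
     \<Rightarrow> ('a, 'm, 'f) placement \<Rightarrow> ('a, 'm, 'f) placement \<Rightarrow> bool" where
  "same_base_metric B F F' \<longleftrightarrow>
     (\<forall>x\<in>points (base B). \<forall>U\<in>tangent_space (base B) x. \<forall>W\<in>tangent_space (base B) x.
        pull_base_metric B F x U W = pull_base_metric B F' x U W)"

end

theory Submission
  imports Defs
begin

text \<open>
  In bundle coordinates, \<open>F\<close> is at each point \<open>X\<close> an injective linear map that covers \<open>Fbar\<close> and
  sends vertical vectors to vertical vectors. The ranks are equal, so it maps the vertical space onto
  the vertical space; hence \<open>Fbar\<close> is injective and the pull-backs are characterised by
  \<open>F (\<Gamma> U) = (Fbar U, 0)\<close> and \<open>F (\<Theta> U) = (0, Fbar U)\<close>. The pseudo-metric is the Euclidean product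
  of the sums of the two components, so its null directions are the vectors \<open>\<Gamma> U - \<Theta> U\<close>; these
  form a complement of the vertical space that is orthogonal to everything. So the pseudo-metric
  determines the complement, and is determined by it together with its vertical restriction. The
  same formula shows that \<open>\<Theta>\<close> is an isometry from the base metric to the micro-metric, onto the
  vertical space when the dimensions agree.
\<close>

section \<open>Tangent spaces in coordinates\<close>

text \<open>Transition maps in \<open>tangent_space\<close> (with \<open>g = snd d\<close>) and
  local expressions in \<open>tangent_map\<close> (with \<open>g = snd d \<circ> f\<close>) are both
  of this form, so that one chain rule serves both.\<close>

definition chart_deriv ::
  "('a, 'e::euclidean_space) chart \<Rightarrow> 'a \<Rightarrow> ('a \<Rightarrow> 'f::euclidean_space) \<Rightarrow> 'e \<Rightarrow> 'f" where
  "chart_deriv c p g = frechet_derivative (g \<circ> chart_inv c) (at (snd c p))"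

definition chart_differentiable ::
  "('a, 'e::euclidean_space) chart \<Rightarrow> 'a \<Rightarrow> ('a \<Rightarrow> 'f::euclidean_space) \<Rightarrow> bool" where
  "chart_differentiable c p g \<longleftrightarrow> (g \<circ> chart_inv c) differentiable at (snd c p)"

lemma chart_inv_apply: "is_chart c \<Longrightarrow> p \<in> fst c \<Longrightarrow> chart_inv c (snd c p) = p"
  by (simp add: chart_inv_def is_chart_def)

lemma smooth_on_imp_differentiable:
  assumes "smooth_on k f S" "1 \<le> k" "x \<in> S"
  shows "f differentiable at x"
proof -
  have "n_smooth_on (Suc 0) f S"
    using assms by (simp add: smooth_on_def one_enat_def del: n_smooth_on.simps)
  then show ?thesis using assms(3) by simp
qed

lemma chart_deriv_works:
  "chart_differentiable c p g \<Longrightarrow> ((g \<circ> chart_inv c) has_derivative chart_deriv c p g) (at (snd c p))"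
  unfolding chart_deriv_def chart_differentiable_def by (rule iffD1[OF frechet_derivative_works])

lemma linear_chart_deriv: "chart_differentiable c p g \<Longrightarrow> linear (chart_deriv c p g)"
  by (rule has_derivative_linear[OF chart_deriv_works])

lemma chart_derivI:
  assumes "((g \<circ> chart_inv c) has_derivative D) (at (snd c p))"
  shows "chart_differentiable c p g" "chart_deriv c p g = D"
  using assms frechet_derivative_at[OF assms]
  by (auto simp: chart_deriv_def chart_differentiable_def intro: differentiableI)

lemma chart_deriv_self:
  assumes "is_chart c" "p \<in> fst c"
  shows "chart_deriv c p (snd c) = (\<lambda>w. w)"
proof (rule chart_derivI)
  have "open (snd c ` fst c)" using assms by (simp add: is_chart_def)
  then show "((snd c \<circ> chart_inv c) has_derivative (\<lambda>w. w)) (at (snd c p))"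
    by (rule has_derivative_transform_within_open[OF has_derivative_ident])
      (use assms in \<open>auto simp: chart_inv_apply\<close>)
qed

text \<open>Only the germ at \<open>p\<close> matters, and the chart domain is a neighbourhood. This
  serves later to compare maps between the bases that agree on base points but were chosen
  arbitrarily elsewhere.\<close>

lemma chart_deriv_cong:
  assumes "is_chart c" "p \<in> fst c" "chart_differentiable c p g"
    and "\<And>q. q \<in> fst c \<Longrightarrow> g q = g' q"
  shows "chart_deriv c p g' = chart_deriv c p g"
proof -
  have "open (snd c ` fst c)" using assms by (simp add: is_chart_def)
  then have "((g' \<circ> chart_inv c) has_derivative chart_deriv c p g) (at (snd c p))"
    by (rule has_derivative_transform_within_open[OF chart_deriv_works[OF assms(3)]])
      (use assms in \<open>auto simp: chart_inv_apply\<close>)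
  then show "chart_deriv c p g' = chart_deriv c p g"
    by (rule chart_derivI(2))
qed

lemma chart_compatible_imp_differentiable:
  assumes "chart_compatible k c d" "1 \<le> k" "p \<in> fst c" "p \<in> fst d"
  shows "chart_differentiable c p (snd d)"
  unfolding chart_differentiable_def
  by (rule smooth_on_imp_differentiable[of k _ "snd c ` (fst c \<inter> fst d)"])
    (use assms in \<open>auto simp: chart_compatible_def\<close>)

text \<open>This is the chain rule. The charts are only assumed compatible, not members of one
  atlas, so that affine trivialising charts are covered too.\<close>

lemma chart_deriv_change:
  assumes "is_chart c" "is_chart d" "chart_compatible k c d" "1 \<le> k" "p \<in> fst c" "p \<in> fst d"
    and g: "chart_differentiable d p g"
  shows "chart_deriv c p g = chart_deriv d p g \<circ> chart_deriv c p (snd d)"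
proof -
  have "((snd d \<circ> chart_inv c) has_derivative chart_deriv c p (snd d)) (at (snd c p))"
    by (rule chart_deriv_works[OF chart_compatible_imp_differentiable[OF assms(3-6)]])
  moreover have "((g \<circ> chart_inv d) has_derivative chart_deriv d p g)
      (at ((snd d \<circ> chart_inv c) (snd c p)))"
    using chart_deriv_works[OF g] chart_inv_apply[OF assms(1,5)] by simp
  ultimately have "(((g \<circ> chart_inv d) \<circ> (snd d \<circ> chart_inv c)) has_derivative
      (chart_deriv d p g \<circ> chart_deriv c p (snd d))) (at (snd c p))"
    by (rule diff_chain_at)
  \<comment> \<open>The inverse chart cancels against the chart on the overlap only, so the chain
    rule is transferred on this open set.\<close>
  moreover have "open (snd c ` (fst c \<inter> fst d))"
    using assms(3) by (simp add: chart_compatible_def)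
  ultimately have "((g \<circ> chart_inv c) has_derivative
      (chart_deriv d p g \<circ> chart_deriv c p (snd d))) (at (snd c p))"
    by (rule has_derivative_transform_within_open)
      (use assms in \<open>auto simp: chart_inv_apply\<close>)
  then show "chart_deriv c p g = chart_deriv d p g \<circ> chart_deriv c p (snd d)"
    by (rule chart_derivI(2))
qed

lemma chart_deriv_inverse:
  assumes "is_chart c" "is_chart d" "chart_compatible k c d" "chart_compatible k d c"
    "1 \<le> k" "p \<in> fst c" "p \<in> fst d"
  shows "chart_deriv d p (snd c) (chart_deriv c p (snd d) w) = w"
proof -
  have "chart_deriv c p (snd c) = chart_deriv d p (snd c) \<circ> chart_deriv c p (snd d)"
    using assms by (intro chart_deriv_change chart_compatible_imp_differentiable) auto
  then show ?thesis using assms by (simp add: chart_deriv_self fun_eq_iff)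
qed

lemma chart_compatible_sym: "chart_compatible k c d \<Longrightarrow> chart_compatible k d c"
  by (auto simp: chart_compatible_def Int_commute)

lemma chart_at:
  assumes "p \<in> points M"
  shows "chart_at M p \<in> M" "p \<in> fst (chart_at M p)"
proof -
  have "\<exists>c. c \<in> M \<and> p \<in> fst c" using assms by (auto simp: points_def)
  from someI_ex[OF this] show "chart_at M p \<in> M" "p \<in> fst (chart_at M p)"
    by (simp_all add: chart_at_def)
qed

section \<open>Tangent vectors as families of chart components\<close>

lemma tangent_space_iff:
  "v \<in> tangent_space M p \<longleftrightarrow>
     (\<forall>c\<in>M. \<forall>d\<in>M. p \<in> fst c \<longrightarrow> p \<in> fst d \<longrightarrow> v d = chart_deriv c p (snd d) (v c)) \<and>
     (\<forall>c. \<not> (c \<in> M \<and> p \<in> fst c) \<longrightarrow> v c = 0)"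
  by (auto simp: tangent_space_def chart_deriv_def)

lemma tangent_space_transition:
  assumes "v \<in> tangent_space M p" "c \<in> M" "d \<in> M" "p \<in> fst c" "p \<in> fst d"
  shows "v d = chart_deriv c p (snd d) (v c)"
  using assms unfolding tangent_space_iff by blast

lemma tangent_space_outside:
  "v \<in> tangent_space M p \<Longrightarrow> \<not> (c \<in> M \<and> p \<in> fst c) \<Longrightarrow> v c = 0"
  unfolding tangent_space_iff by blast

lemma tangent_map_apply:
  "snd (tangent_map M N f (p, v)) d =
    (if d \<in> N \<and> f p \<in> fst d
     then chart_deriv (chart_at M p) p (snd d \<circ> f) (v (chart_at M p)) else 0)"
  by (simp add: tangent_map_def chart_deriv_def)

lemma smooth_map_imp_differentiable:
  assumes "smooth_map k M N f" "1 \<le> k" "c \<in> M" "d \<in> N" "p \<in> fst c" "f p \<in> fst d"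
  shows "chart_differentiable c p (snd d \<circ> f)"
proof -
  have "smooth_on k (snd d \<circ> f \<circ> chart_inv c) (snd c ` (fst c \<inter> f -` fst d))"
    using assms(1,3,4) unfolding smooth_map_def by blast
  moreover have "snd c p \<in> snd c ` (fst c \<inter> f -` fst d)"
    using assms(5,6) by blast
  ultimately show ?thesis
    unfolding chart_differentiable_def using smooth_on_imp_differentiable assms(2) by blast
qed

locale smooth_atlas =
  fixes k :: enat and M :: "('a, 'e::euclidean_space) chart set"
  assumes atlas: "atlas k M" and one_le: "1 \<le> k"
begin

lemma is_chart: "c \<in> M \<Longrightarrow> is_chart c"
  using atlas by (simp add: atlas_def)

lemma compatible: "c \<in> M \<Longrightarrow> d \<in> M \<Longrightarrow> chart_compatible k c d"
  using atlas by (simp add: atlas_def)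

lemma transition_differentiable:
  assumes "c \<in> M" "d \<in> M" "p \<in> fst c" "p \<in> fst d"
  shows "chart_differentiable c p (snd d)"
  by (rule chart_compatible_imp_differentiable[OF compatible[OF assms(1,2)] one_le assms(3,4)])

lemma transition_linear:
  assumes "c \<in> M" "d \<in> M" "p \<in> fst c" "p \<in> fst d"
  shows "linear (chart_deriv c p (snd d))"
  by (rule linear_chart_deriv[OF transition_differentiable[OF assms]])

lemma tangent_space_combination:
  assumes "u \<in> tangent_space M p" "v \<in> tangent_space M p"
  shows "(\<lambda>c. r *\<^sub>R u c + s *\<^sub>R v c) \<in> tangent_space M p"
  unfolding tangent_space_iff
proof (intro conjI ballI impI allI)
  fix c d assume *: "c \<in> M" "d \<in> M" "p \<in> fst c" "p \<in> fst d"
  note uv = assms[THEN tangent_space_transition, OF *]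
  show "r *\<^sub>R u d + s *\<^sub>R v d = chart_deriv c p (snd d) (r *\<^sub>R u c + s *\<^sub>R v c)"
    unfolding uv linear_add[OF transition_linear[OF *]] linear_scale[OF transition_linear[OF *]] ..
next
  fix c assume "\<not> (c \<in> M \<and> p \<in> fst c)"
  from assms[THEN tangent_space_outside, OF this] show "r *\<^sub>R u c + s *\<^sub>R v c = 0"
    by simp
qed

lemma tangent_space_zero: "(\<lambda>_. 0) \<in> tangent_space M p"
  unfolding tangent_space_iff using transition_linear by (simp add: linear_0)

text \<open>One component fixes a tangent vector: transition maps give the components in the other
  charts around \<open>p\<close>, and all remaining ones are zero.\<close>

lemma tangent_space_eqI:
  assumes "u \<in> tangent_space M p" "v \<in> tangent_space M p" "c \<in> M" "p \<in> fst c" "u c = v c"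
  shows "u = v"
proof
  fix d
  show "u d = v d"
  proof (cases "d \<in> M \<and> p \<in> fst d")
    case True
    then show ?thesis
      using assms(1,2)[THEN tangent_space_transition, of c d] assms(3-5) by metis
  next
    case False
    from assms(1,2)[THEN tangent_space_outside, OF this] show ?thesis by simp
  qed
qed

text \<open>The prescribed component is carried to every other chart by the derivative of the
  transition map; the chain rule is the cocycle identity that makes the resulting family
  consistent.\<close>

lemma tangent_vector_exists:
  assumes c: "c \<in> M" "p \<in> fst c"
  obtains v where "v \<in> tangent_space M p" "v c = w"
proof
  let ?v = "\<lambda>d. if d \<in> M \<and> p \<in> fst d then chart_deriv c p (snd d) w else 0"
  show "?v \<in> tangent_space M p"
    unfolding tangent_space_iff
  proof (intro conjI ballI impI allI)
    fix d e assume "d \<in> M" "e \<in> M" "p \<in> fst d" "p \<in> fst e"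
    moreover from this have "chart_deriv c p (snd e) = chart_deriv d p (snd e) \<circ> chart_deriv c p (snd d)"
      using c by (intro chart_deriv_change[OF _ _ _ one_le] is_chart compatible
          transition_differentiable) auto
    ultimately show "?v e = chart_deriv d p (snd e) (?v d)" by simp
  qed auto
  show "?v c = w"
    using c by (simp add: chart_deriv_self is_chart)
qed

lemma points_tangent_bundle:
  "points (tangent_bundle M) = {(p, v). p \<in> points M \<and> v \<in> tangent_space M p}"
  by (auto simp: points_def tangent_bundle_def tangent_chart_def)

text \<open>Needed to identify the underlying set of the manifold topology of the tangent bundle, on
  which an embedding is injective.\<close>

lemma is_chart_tangent_chart:
  assumes "c \<in> M"
  shows "is_chart (tangent_chart M c)"
proof -
  have "snd (tangent_chart M c) ` fst (tangent_chart M c) = (snd c ` fst c) \<times> UNIV"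
  proof (intro equalityI subsetI)
    fix z assume "z \<in> (snd c ` fst c) \<times> (UNIV :: 'e set)"
    then obtain p w where p: "p \<in> fst c" "z = (snd c p, w)" by auto
    obtain v where "v \<in> tangent_space M p" "v c = w"
      using tangent_vector_exists assms p by metis
    then show "z \<in> snd (tangent_chart M c) ` fst (tangent_chart M c)"
      using p by (force simp: tangent_chart_def)
  qed (auto simp: tangent_chart_def)
  moreover have "inj_on (snd (tangent_chart M c)) (fst (tangent_chart M c))"
  proof (rule inj_onI)
    fix z z' assume z: "z \<in> fst (tangent_chart M c)" "z' \<in> fst (tangent_chart M c)"
      and eq: "snd (tangent_chart M c) z = snd (tangent_chart M c) z'"
    obtain p v p' v' where [simp]: "z = (p, v)" "z' = (p', v')" by fastforce
    from z eq have *: "p \<in> fst c" "p' \<in> fst c" "snd c p = snd c p'"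
      "v \<in> tangent_space M p" "v' \<in> tangent_space M p'" "v c = v' c"
      by (auto simp: tangent_chart_def)
    then have "p = p'"
      using is_chart[OF assms] by (auto simp: is_chart_def dest: inj_onD)
    with * show "z = z'"
      using tangent_space_eqI[OF _ _ assms] by auto
  qed
  ultimately show ?thesis
    using is_chart[OF assms] by (auto simp: is_chart_def intro: open_Times)
qed

text \<open>By the chain rule, a change of chart in the target acts after the local expression of
  \<open>f\<close>, which is how components of a tangent vector must transform.\<close>

lemma tangent_map_in_tangent_space:
  assumes N: "smooth_atlas k N" and f: "smooth_map k M N f" and p: "p \<in> points M"
  shows "snd (tangent_map M N f (p, v)) \<in> tangent_space N (f p)"
proof -
  interpret N: smooth_atlas k N by (rule N)
  let ?c = "chart_at M p"
  note c = chart_at[OF p]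
  have diff: "chart_differentiable ?c p (snd d \<circ> f)" if "d \<in> N" "f p \<in> fst d" for d
    by (rule smooth_map_imp_differentiable[OF f one_le c(1) that(1) c(2) that(2)])
  have "chart_deriv ?c p (snd e \<circ> f) = chart_deriv d (f p) (snd e) \<circ> chart_deriv ?c p (snd d \<circ> f)"
    if *: "d \<in> N" "e \<in> N" "f p \<in> fst d" "f p \<in> fst e" for d e
  proof (rule chart_derivI(2))
    have "((snd e \<circ> chart_inv d) has_derivative chart_deriv d (f p) (snd e))
        (at ((snd d \<circ> f \<circ> chart_inv ?c) (snd ?c p)))"
      using chart_deriv_works[OF N.transition_differentiable[OF *]] c(2)
        chart_inv_apply[OF is_chart[OF c(1)] c(2)] by simp
    with chart_deriv_works[OF diff]
    have "((snd e \<circ> chart_inv d) \<circ> (snd d \<circ> f \<circ> chart_inv ?c) has_derivative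
        chart_deriv d (f p) (snd e) \<circ> chart_deriv ?c p (snd d \<circ> f)) (at (snd ?c p))"
      by (rule diff_chain_at) (use * in auto)
    \<comment> \<open>On this set \<open>chart_inv d\<close> undoes \<open>snd d\<close> along
      \<open>f\<close>; its openness is part of \<open>smooth_map\<close>.\<close>
    moreover have "open (snd ?c ` (fst ?c \<inter> f -` fst d))"
      using f c * by (simp add: smooth_map_def)
    ultimately show "(snd e \<circ> f \<circ> chart_inv ?c has_derivative
        chart_deriv d (f p) (snd e) \<circ> chart_deriv ?c p (snd d \<circ> f)) (at (snd ?c p))"
      by (rule has_derivative_transform_within_open)
        (use * c in \<open>auto simp: chart_inv_apply is_chart N.is_chart\<close>)
  qed
  note trans = this
  show "snd (tangent_map M N f (p, v)) \<in> tangent_space N (f p)"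
    unfolding tangent_space_iff
  proof (intro conjI ballI impI allI)
    fix d e assume *: "d \<in> N" "e \<in> N" "f p \<in> fst d" "f p \<in> fst e"
    show "snd (tangent_map M N f (p, v)) e =
        chart_deriv d (f p) (snd e) (snd (tangent_map M N f (p, v)) d)"
      using fun_cong[OF trans[OF *], of "v ?c"] * by (simp only: tangent_map_apply comp_apply if_True simp_thms)
  qed (auto simp: tangent_map_apply)
qed

end

section \<open>Manifold topology and injectivity of embeddings\<close>

lemma topspace_manifold_topology:
  assumes "\<And>c. c \<in> M \<Longrightarrow> is_chart c"
  shows "topspace (manifold_topology M) = points M"
proof
  show "topspace (manifold_topology M) \<subseteq> points M"
    using openin_topspace[of "manifold_topology M"] openin_manifold_topology[OF assms] by blast
  have "points M \<inter> fst c = fst c" if "c \<in> M" for c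
    using that by (auto simp: points_def)
  then have "openin (manifold_topology M) (points M)"
    using assms by (auto simp: openin_manifold_topology is_chart_def)
  then show "points M \<subseteq> topspace (manifold_topology M)"
    by (rule openin_subset)
qed

text \<open>An embedding is a homeomorphism onto its image. Applied to \<open>F\<close> itself on
  the tangent bundle, this gives injectivity on each tangent space without differentiating
  \<open>F\<close>.\<close>

lemma inj_on_differential_embedding:
  assumes "\<And>c. c \<in> M \<Longrightarrow> is_chart c" "differential_embedding k M N f"
  shows "inj_on f (points M)"
proof -
  have "embedding_map (manifold_topology M) (manifold_topology N) f"
    using assms(2) by (simp add: differential_embedding_def)
  then have "inj_on f (topspace (manifold_topology M))"
    using embedding_map_def homeomorphic_imp_injective_map by blast
  then show ?thesis using topspace_manifold_topology assms(1) by metis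
qed


lemma chart_deriv_fst:
  assumes "chart_differentiable c p g"
  shows "chart_deriv c p (fst \<circ> g) w = fst (chart_deriv c p g w)"
proof -
  have "((fst \<circ> g \<circ> chart_inv c) has_derivative (\<lambda>w. fst (chart_deriv c p g w))) (at (snd c p))"
    using has_derivative_fst[OF chart_deriv_works[OF assms]] by (simp add: comp_def)
  then show ?thesis by (simp add: chart_derivI(2))
qed

section \<open>A fibre of the material bundle\<close>

lemma chart_inv_eucl_chart: "chart_inv eucl_chart = (\<lambda>x. x)"
  by (simp add: chart_inv_def eucl_chart_def inv_into_def fun_eq_iff)

lemma tangent_space_eucl:
  assumes "w \<in> tangent_space {eucl_chart} e"
  shows "w = eucl_vec (w eucl_chart)"
  using tangent_space_outside[OF assms] by (auto simp: eucl_vec_def fun_eq_iff)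

text \<open>The ambient projection is linear in the canonical coordinates and hence is its own
  derivative.\<close>

lemma tangent_map_ambient_proj:
  "snd (tangent_map (total ambient) (base ambient) (proj ambient) (e, w)) eucl_chart =
     fst (w eucl_chart)"
proof -
  have "chart_at {eucl_chart} e = eucl_chart"
    using chart_at(1)[of e "{eucl_chart}"] by (auto simp: points_def eucl_chart_def)
  moreover have "chart_deriv eucl_chart e (snd eucl_chart \<circ> fst) = fst"
    by (rule chart_derivI(2))
      (auto simp: eucl_chart_def comp_def chart_inv_eucl_chart[unfolded eucl_chart_def]
        intro!: derivative_eq_intros)
  ultimately show ?thesis
    by (simp add: tangent_map_apply ambient_def) (simp add: eucl_chart_def)
qed

lemma tangent_map_to_ambient_base:
  "snd (tangent_map M (base ambient) h (p, v)) eucl_chart =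
     chart_deriv (chart_at M p) p h (v (chart_at M p))"
  by (simp add: tangent_map_def chart_deriv_def ambient_def eucl_chart_def)

text \<open>The class is \<open>k + 1\<close> because passing to the tangent bundle, where
  placements of class \<open>k\<close> live, costs one derivative.\<close>

locale material_point =
  fixes k :: enat
    and B :: "('a, 'b, 'm::euclidean_space, 'f::euclidean_space) fibration"
    and X :: 'a
  assumes one_le: "1 \<le> k"
    and bdl: "affine_bundle (k + 1) B"
    and rank: "DIM('f) = 3"
    and X: "X \<in> points (total B)"
begin

sublocale total: smooth_atlas "k + 1" "total B"
  using bdl by unfold_locales (auto simp: affine_bundle_def manifold_def)

sublocale base: smooth_atlas "k + 1" "base B"
  using bdl by unfold_locales (auto simp: affine_bundle_def manifold_def)

abbreviation "T \<equiv> tangent_space (total B) X"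
abbreviation "Tb \<equiv> tangent_space (base B) (proj B X)"
abbreviation "V \<equiv> vertical B X"

definition dproj :: "('a, 'm \<times> 'f) tvec \<Rightarrow> ('b, 'm) tvec" where
  "dproj u = snd (tangent_map (total B) (base B) (proj B) (X, u))"

lemma proj_X: "proj B X \<in> points (base B)"
  using X bdl by (auto simp: affine_bundle_def)

lemma vertical_iff: "u \<in> V \<longleftrightarrow> u \<in> T \<and> dproj u = (\<lambda>_. 0)"
  by (simp add: vertical_def dproj_def)

lemma dproj_in_Tb: "dproj u \<in> Tb"
  unfolding dproj_def
  using X bdl by (intro total.tangent_map_in_tangent_space base.smooth_atlas_axioms)
    (auto simp: affine_bundle_def)

lemma dproj_combination:
  "dproj (\<lambda>c. r *\<^sub>R u c + s *\<^sub>R v c) = (\<lambda>d. r *\<^sub>R dproj u d + s *\<^sub>R dproj v d)"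
proof
  fix d
  show "dproj (\<lambda>c. r *\<^sub>R u c + s *\<^sub>R v c) d = r *\<^sub>R dproj u d + s *\<^sub>R dproj v d"
  proof (cases "d \<in> base B \<and> proj B X \<in> fst d")
    case True
    then have "chart_differentiable (chart_at (total B) X) X (snd d \<circ> proj B)"
      using bdl X total.one_le chart_at
      by (intro smooth_map_imp_differentiable[of "k + 1" "total B" "base B"])
        (auto simp: affine_bundle_def)
    from linear_chart_deriv[OF this] show ?thesis
      using True by (simp add: dproj_def tangent_map_apply linear_add linear_scale)
  next
    case False
    then have "dproj w d = 0" for w by (auto simp: dproj_def tangent_map_apply)
    then show ?thesis by simp
  qed
qed

text \<open>In an affine trivialising chart the projection is \<open>fst\<close>. The map
  \<open>g\<close> sends a coordinate vector to its tangent vector and serves to transfer dimension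
  counts to \<open>T\<close>.\<close>

lemma bundle_coordinates:
  obtains g :: "'m \<times> 'f \<Rightarrow> ('a, 'm \<times> 'f) tvec" and c
  where "c \<in> base B" "proj B X \<in> fst c" "\<And>z. g z \<in> T" "\<And>z. dproj (g z) c = fst z"
    "\<And>z w r s. g (r *\<^sub>R z + s *\<^sub>R w) = (\<lambda>d. r *\<^sub>R g z d + s *\<^sub>R g w d)" "inj g"
proof -
  obtain t where t: "t \<in> trivs B" "proj B X \<in> fst t"
    using proj_X bdl by (auto simp: affine_bundle_def)
  obtain c where c: "c \<in> base B" "proj B X \<in> fst c"
    using proj_X by (auto simp: points_def)
  define q where "q = aff_chart B t c"
  \<comment> \<open>The affine chart \<open>q\<close> need not belong to the atlas, so a tangent
    vector is specified by its component in the atlas chart \<open>e\<close>, computed with the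
    derivative of the change from \<open>q\<close> to \<open>e\<close>.\<close>
  define e where "e = chart_at (total B) X"
  have e: "e \<in> total B" "X \<in> fst e" using chart_at[OF X] by (simp_all add: e_def)
  have q: "is_chart q" "chart_compatible (k + 1) q e" "X \<in> fst q"
    using bdl t c e X by (auto simp: affine_bundle_def q_def aff_chart_def)
  note qe = q chart_compatible_sym[OF q(2)] e total.is_chart[OF e(1)] total.one_le
  have diff: "chart_differentiable e X (snd q)" "chart_differentiable q X (snd e)"
    by (rule chart_compatible_imp_differentiable[OF qe(4) total.one_le e(2) q(3)],
        rule chart_compatible_imp_differentiable[OF q(2) total.one_le q(3) e(2)])
  have "\<exists>u. u \<in> T \<and> u e = w" for w
    by (rule total.tangent_vector_exists[OF e]) blast
  then have "\<exists>g. \<forall>z. g z \<in> T \<and> g z e = chart_deriv q X (snd e) z"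
    by (intro choice) blast
  then obtain g where g: "\<And>z. g z \<in> T \<and> g z e = chart_deriv q X (snd e) z"
    by blast
  have dproj: "dproj u c = fst (chart_deriv e X (snd q) (u e))" for u
  proof -
    have "snd c \<circ> proj B = fst \<circ> snd q" by (auto simp: q_def aff_chart_def)
    then have "dproj u c = chart_deriv e X (fst \<circ> snd q) (u e)"
      using c by (simp add: dproj_def tangent_map_apply e_def)
    then show ?thesis unfolding chart_deriv_fst[OF diff(1)] .
  qed
  have inv: "chart_deriv e X (snd q) (g z e) = z" for z
    using chart_deriv_inverse[OF q(1) qe(7) q(2) qe(4) total.one_le q(3) e(2)] g by metis
  show thesis
  proof
    show "c \<in> base B" "proj B X \<in> fst c" "g z \<in> T" "dproj (g z) c = fst z" for z
      using c g inv dproj by auto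
    show "g (r *\<^sub>R z + s *\<^sub>R w) = (\<lambda>d. r *\<^sub>R g z d + s *\<^sub>R g w d)" for z w r s
    proof (rule total.tangent_space_eqI[where c = e])
      show "g (r *\<^sub>R z + s *\<^sub>R w) e = r *\<^sub>R g z e + s *\<^sub>R g w e"
        using g linear_chart_deriv[OF diff(2)] by (simp add: linear_add linear_scale)
      show "g (r *\<^sub>R z + s *\<^sub>R w) \<in> T" using g by blast
      show "(\<lambda>d. r *\<^sub>R g z d + s *\<^sub>R g w d) \<in> T"
        using g total.tangent_space_combination by blast
    qed (fact e)+
    show "inj g" using inv by (metis injI)
  qed
qed

lemma dproj_onto:
  assumes "U \<in> Tb"
  obtains u where "u \<in> T" "dproj u = U"
proof -
  obtain g :: "'m \<times> 'f \<Rightarrow> ('a, 'm \<times> 'f) tvec" and c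
    where c: "c \<in> base B" "proj B X \<in> fst c"
      and g: "\<And>z. g z \<in> T" "\<And>z. dproj (g z) c = fst z"
    by (rule bundle_coordinates) blast
  have "dproj (g (U c, 0)) = U"
    by (rule base.tangent_space_eqI[OF dproj_in_Tb assms c]) (simp add: g)
  with g(1) show thesis by (rule that)
qed

lemma base_coordinates:
  obtains b :: "'m \<Rightarrow> ('b, 'm) tvec"
  where "\<And>z. b z \<in> Tb" "\<And>z w r s. b (r *\<^sub>R z + s *\<^sub>R w) = (\<lambda>d. r *\<^sub>R b z d + s *\<^sub>R b w d)" "inj b"
proof -
  obtain c where c: "c \<in> base B" "proj B X \<in> fst c"
    using proj_X by (auto simp: points_def)
  have "\<exists>u. u \<in> Tb \<and> u c = w" for w
    by (rule base.tangent_vector_exists[OF c]) blast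
  then have "\<exists>b. \<forall>z. b z \<in> Tb \<and> b z c = z"
    by (intro choice) blast
  then obtain b where b: "\<And>z. b z \<in> Tb \<and> b z c = z"
    by blast
  show thesis
  proof
    show "b z \<in> Tb" for z using b by simp
    show "b (r *\<^sub>R z + s *\<^sub>R w) = (\<lambda>d. r *\<^sub>R b z d + s *\<^sub>R b w d)" for z w r s
      by (rule base.tangent_space_eqI[OF _ base.tangent_space_combination c]) (simp_all add: b)
    show "inj b" using b by (metis injI)
  qed
qed

end

section \<open>A placement at a point\<close>

lemma linear_inj_imp_surj_DIM:
  fixes h :: "'x::euclidean_space \<Rightarrow> 'y::euclidean_space"
  assumes "linear h" "inj h" "DIM('x) = DIM('y)"
  shows "surj h"
proof -
  have "dim (range h) = DIM('y)"
    using assms by (simp add: dim_image_eq)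
  then show ?thesis
    using assms(1) by (metis dim_eq_full linear_subspace_image span_eq_iff subspace_UNIV)
qed

lemma L_paE:
  assumes "L \<in> L_pa k A D"
  obtains l where "smooth_map k (tangent_bundle (total A)) (tangent_bundle (total D)) L"
    "l \<in> Aff k A D"
    "\<forall>a\<in>points (total A). \<forall>u\<in>tangent_space (total A) a. fst (L (a, u)) = l a"
    "\<forall>a\<in>points (total A). \<forall>u\<in>tangent_space (total A) a. \<forall>v\<in>tangent_space (total A) a. \<forall>r s.
       snd (L (a, \<lambda>c. r *\<^sub>R u c + s *\<^sub>R v c)) =
         (\<lambda>d. r *\<^sub>R snd (L (a, u)) d + s *\<^sub>R snd (L (a, v)) d)"
    "\<forall>a\<in>points (total A). \<forall>u\<in>tangent_space (total A) a.
       tangent_map (total D) (base D) (proj D) (L (a, u)) =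
       tangent_map (base A) (base D) (base_map A D l)
         (tangent_map (total A) (base A) (proj A) (a, u))"
  using assms unfolding L_pa_def by (elim CollectE conjE bexE) (rule that; assumption)

lemma AffE:
  assumes "l \<in> Aff k A D"
  obtains lb where "smooth_map k (base A) (base D) lb"
    "\<forall>a\<in>points (total A). proj D (l a) = lb (proj A a)"
  using assms unfolding Aff_def by (elim CollectE conjE bexE exE) (rule that; assumption)

section \<open>The linear map induced by a placement on one tangent space\<close>

locale placed_point = material_point k B X
  for k :: enat and B :: "('a, 'b, 'm::euclidean_space, 'f::euclidean_space) fibration" and X :: 'a +
  fixes F :: "('a, 'm, 'f) placement"
  assumes F: "F \<in> Conf k B ambient"
begin

text \<open>The ambient atlas has a single chart, so its component carries the whole vector:
  \<open>f\<close> is F at \<open>X\<close> and \<open>fb\<close> is Fbar, both with values in a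
  Euclidean space.\<close>

definition f :: "('a, 'm \<times> 'f) tvec \<Rightarrow> space \<times> space" where
  "f u = snd (F (X, u)) eucl_chart"

definition fb :: "('b, 'm) tvec \<Rightarrow> space" where
  "fb U = snd (base_tangent B ambient F (proj B X, U)) eucl_chart"

lemma F_in_L_pa: "F \<in> L_pa k B ambient"
  using F by (simp add: Conf_def)

lemma fst_F:
  assumes "a \<in> points (total B)" "u \<in> tangent_space (total B) a"
  shows "fst (F (a, u)) = shadow F a"
proof -
  obtain l where "\<forall>a\<in>points (total B). \<forall>u\<in>tangent_space (total B) a. fst (F (a, u)) = l a"
    using F_in_L_pa by (rule L_paE)
  then show ?thesis
    using assms total.tangent_space_zero[of a] by (simp add: shadow_def)
qed

lemma f_combination:
  assumes "u \<in> T" "v \<in> T"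
  shows "f (\<lambda>c. r *\<^sub>R u c + s *\<^sub>R v c) = r *\<^sub>R f u + s *\<^sub>R f v"
proof -
  have "snd (F (X, \<lambda>c. r *\<^sub>R u c + s *\<^sub>R v c)) =
      (\<lambda>d. r *\<^sub>R snd (F (X, u)) d + s *\<^sub>R snd (F (X, v)) d)"
    by (rule L_paE[OF F_in_L_pa]) (use X assms in blast)
  then show ?thesis by (simp add: f_def)
qed

lemma F_eq:
  assumes "u \<in> T"
  shows "F (X, u) = (shadow F X, eucl_vec (f u))"
proof -
  have "smooth_map k (tangent_bundle (total B)) (tangent_bundle (total ambient)) F"
    using F_in_L_pa by (rule L_paE)
  then have "F ` points (tangent_bundle (total B)) \<subseteq> points (tangent_bundle (total ambient))"
    unfolding smooth_map_def by blast
  moreover have "(X, u) \<in> points (tangent_bundle (total B))"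
    using X assms by (simp add: total.points_tangent_bundle)
  ultimately have "F (X, u) \<in> points (tangent_bundle (total ambient))" by blast
  then have "snd (F (X, u)) \<in> tangent_space {eucl_chart} (fst (F (X, u)))"
    by (auto simp: points_def tangent_bundle_def tangent_chart_def ambient_def)
  then have "snd (F (X, u)) = eucl_vec (f u)"
    unfolding f_def by (rule tangent_space_eucl)
  then show ?thesis
    using fst_F[OF X assms] by (simp add: prod_eq_iff)
qed

text \<open>All values of \<open>F\<close> at \<open>X\<close> share the base point
  \<open>shadow F X\<close>, so injectivity of \<open>F\<close> on the tangent bundle passes to the
  vector part.\<close>

lemma f_inj: "inj_on f T"
proof -
  have "differential_embedding k (tangent_bundle (total B)) (tangent_bundle (total ambient)) F"
    using F by (simp add: Conf_def)
  then have "inj_on F (points (tangent_bundle (total B)))"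
    by (rule inj_on_differential_embedding[rotated])
      (auto simp: tangent_bundle_def total.is_chart_tangent_chart)
  then show ?thesis
    using X F_eq by (auto simp: inj_on_def total.points_tangent_bundle)
qed

text \<open>Three maps between the bases meet here: the base map of the witness in
  \<open>L_pa\<close>, the base map of the shadow in \<open>base_tangent\<close>, and the smooth map
  \<open>lb\<close> from \<open>Aff\<close>. They agree on base points, so the smoothness of
  \<open>lb\<close> makes \<open>fb\<close> linear, and the covering condition of
  \<open>L_pa\<close> becomes a statement about \<open>fb\<close>.\<close>

lemma
  shows fst_f: "u \<in> T \<Longrightarrow> fst (f u) = fb (dproj u)"
    and fb_combination: "fb (\<lambda>c. r *\<^sub>R U c + s *\<^sub>R W c) = r *\<^sub>R fb U + s *\<^sub>R fb W"
proof -
  obtain l where l: "l \<in> Aff k B ambient"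
    and lF: "\<forall>a\<in>points (total B). \<forall>u\<in>tangent_space (total B) a. fst (F (a, u)) = l a"
    and base: "\<forall>a\<in>points (total B). \<forall>u\<in>tangent_space (total B) a.
        tangent_map (total ambient) (base ambient) (proj ambient) (F (a, u)) =
        tangent_map (base B) (base ambient) (base_map B ambient l)
          (tangent_map (total B) (base B) (proj B) (a, u))"
    using F_in_L_pa by (rule L_paE)
  have shadow: "shadow F a = l a" if "a \<in> points (total B)" for a
    using lF that total.tangent_space_zero[of a] by (simp add: shadow_def)
  have fst_f: "fst (f u) =
      snd (tangent_map (base B) (base ambient) (base_map B ambient l) (proj B X, dproj u)) eucl_chart"
    if "u \<in> T" for u
  proof -
    have "tangent_map (total B) (base B) (proj B) (X, u) = (proj B X, dproj u)"
      by (simp add: dproj_def tangent_map_def)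
    then have "tangent_map (total ambient) (base ambient) (proj ambient) (F (X, u)) =
        tangent_map (base B) (base ambient) (base_map B ambient l) (proj B X, dproj u)"
      using base X that by simp
    moreover have "F (X, u) = (fst (F (X, u)), snd (F (X, u)))" by simp
    ultimately show ?thesis
      unfolding f_def using tangent_map_ambient_proj by metis
  qed
  obtain lb where lb: "smooth_map k (base B) (base ambient) lb"
    "\<forall>a\<in>points (total B). proj ambient (l a) = lb (proj B a)"
    using l by (rule AffE)
  \<comment> \<open>\<open>base_map\<close> picks some point of the fibre; the choice is harmless
    because \<open>l\<close> covers \<open>lb\<close>.\<close>
  have eq: "lb x = base_map B ambient l x" "lb x = base_map B ambient (shadow F) x"
    if "x \<in> points (base B)" for x
  proof -
    have "x \<in> proj B ` points (total B)"
      using that bdl by (simp add: affine_bundle_def)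
    then have "\<exists>a. a \<in> fibre B x" by (auto simp: fibre_def)
    then have "(SOME a. a \<in> fibre B x) \<in> fibre B x" by (rule someI_ex)
    then show "lb x = base_map B ambient l x" "lb x = base_map B ambient (shadow F) x"
      using lb(2) shadow by (simp_all add: base_map_def fibre_def)
  qed
  let ?c = "chart_at (base B) (proj B X)"
  note c = chart_at[OF proj_X]
  have c_points: "x \<in> points (base B)" if "x \<in> fst ?c" for x
    using that c(1) by (auto simp: points_def)
  have "chart_differentiable ?c (proj B X) (snd eucl_chart \<circ> lb)"
    by (rule smooth_map_imp_differentiable[OF lb(1) one_le c(1) _ c(2)])
      (simp_all add: ambient_def eucl_chart_def)
  then have diff: "chart_differentiable ?c (proj B X) lb"
    by (simp add: eucl_chart_def)
  note same = chart_deriv_cong[OF base.is_chart[OF c(1)] c(2) diff]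
  have l_eq: "chart_deriv ?c (proj B X) (base_map B ambient l) = chart_deriv ?c (proj B X) lb"
    by (rule same) (rule eq(1)[OF c_points])
  have shadow_eq: "chart_deriv ?c (proj B X) (base_map B ambient (shadow F)) =
      chart_deriv ?c (proj B X) lb"
    by (rule same) (rule eq(2)[OF c_points])
  have fb: "fb U = chart_deriv ?c (proj B X) lb (U ?c)" for U
    unfolding fb_def base_tangent_def tangent_map_to_ambient_base shadow_eq ..
  show "u \<in> T \<Longrightarrow> fst (f u) = fb (dproj u)"
    using fst_f unfolding fb tangent_map_to_ambient_base l_eq .
  show "fb (\<lambda>c. r *\<^sub>R U c + s *\<^sub>R W c) = r *\<^sub>R fb U + s *\<^sub>R fb W"
    unfolding fb using linear_chart_deriv[OF diff] by (simp add: linear_add linear_scale)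
qed

lemma fb_zero: "fb (\<lambda>_. 0) = 0"
  using fb_combination[of 0 "\<lambda>_. 0" 0 "\<lambda>_. 0"] by simp

text \<open>A vertical vector projects to zero, so its image has first component zero. The second
  component is then an injective linear function of the fibre coordinates, and both sides have
  dimension 3.\<close>

lemma f_vertical_onto:
  obtains v where "v \<in> V" "f v = (0, y)"
proof -
  obtain g :: "'m \<times> 'f \<Rightarrow> ('a, 'm \<times> 'f) tvec" and c where g: "c \<in> base B" "proj B X \<in> fst c" "\<And>z. g z \<in> T" "\<And>z. dproj (g z) c = fst z"
    "\<And>z w r s. g (r *\<^sub>R z + s *\<^sub>R w) = (\<lambda>d. r *\<^sub>R g z d + s *\<^sub>R g w d)" "inj g"
    by (rule bundle_coordinates) blast
  have vert: "g (0, b) \<in> V" for b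
    using g base.tangent_space_eqI[OF dproj_in_Tb base.tangent_space_zero g(1,2)]
    by (simp add: vertical_iff)
  then have fst0: "fst (f (g (0, b))) = 0" for b
    by (simp add: fst_f vertical_iff fb_zero)
  define h where "h b = snd (f (g (0, b)))" for b
  have "h (r *\<^sub>R b + s *\<^sub>R b') = r *\<^sub>R h b + s *\<^sub>R h b'" for r s b b'
    using g(5)[of r "(0, b)" s "(0, b')"] g(3) f_combination by (simp add: h_def)
  \<comment> \<open>Coefficients 1 and 1 give additivity, and a second coefficient 0 gives
    homogeneity.\<close>
  from this[of 1 _ 1] this[of _ _ 0] have "linear h"
    by (intro linearI) simp_all
  moreover have "inj h"
  proof (rule injI)
    fix b b' assume "h b = h b'"
    then have "f (g (0, b)) = f (g (0, b'))"
      using fst0 by (simp add: h_def prod_eq_iff)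
    then have "g (0, b) = g (0, b')" using inj_onD[OF f_inj _ g(3) g(3)] by blast
    then show "b = b'" using injD[OF g(6)] by blast
  qed
  ultimately have "surj h"
    using rank by (intro linear_inj_imp_surj_DIM) auto
  then obtain b where "h b = y" by (metis surjD)
  with fst0[of b] have "f (g (0, b)) = (0, y)"
    by (simp add: h_def prod_eq_iff)
  with vert that show thesis by blast
qed

text \<open>If \<open>fb U = fb W\<close>, lifts of \<open>U\<close> and \<open>W\<close> have
  images that differ only in the second component. A vertical vector makes up the difference, so by
  injectivity of \<open>f\<close> the lifts differ by it and have the same projection.\<close>

lemma fb_inj: "inj_on fb Tb"
proof (rule inj_onI)
  fix U W assume "U \<in> Tb" "W \<in> Tb" and eq: "fb U = fb W"
  obtain u where u: "u \<in> T" "dproj u = U" by (rule dproj_onto[OF \<open>U \<in> Tb\<close>])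
  obtain w where w: "w \<in> T" "dproj w = W" by (rule dproj_onto[OF \<open>W \<in> Tb\<close>])
  obtain v where "v \<in> V" and v: "f v = (0, snd (f u) - snd (f w))"
    by (rule f_vertical_onto)
  then have vT: "v \<in> T" "dproj v = (\<lambda>_. 0)" by (simp_all add: vertical_iff)
  let ?w = "\<lambda>c. 1 *\<^sub>R w c + 1 *\<^sub>R v c"
  have "f ?w = f u"
    unfolding f_combination[OF w(1) vT(1)] using v eq u w fst_f by (simp add: prod_eq_iff)
  then have "?w = u"
    by (rule inj_onD[OF f_inj _ total.tangent_space_combination[OF w(1) vT(1)] u(1)])
  with dproj_combination[of 1 w 1 v] have "dproj u = (\<lambda>d. 1 *\<^sub>R dproj w d + 1 *\<^sub>R dproj v d)"
    by (simp only:)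
  then show "U = W" using u(2) w(2) vT(2) by simp
qed

text \<open>Any lift of \<open>U\<close> has the right first component; adding a vertical vector
  adjusts the second.\<close>

lemma f_onto:
  assumes "U \<in> Tb"
  obtains u where "u \<in> T" "f u = (fb U, y)"
proof -
  obtain u where u: "u \<in> T" "dproj u = U" by (rule dproj_onto[OF assms])
  obtain v where "v \<in> V" and v: "f v = (0, y - snd (f u))"
    by (rule f_vertical_onto)
  then have vT: "v \<in> T" by (simp add: vertical_iff)
  show thesis
  proof
    show "(\<lambda>c. 1 *\<^sub>R u c + 1 *\<^sub>R v c) \<in> T"
      by (rule total.tangent_space_combination[OF u(1) vT])
    show "f (\<lambda>c. 1 *\<^sub>R u c + 1 *\<^sub>R v c) = (fb U, y)"
      unfolding f_combination[OF u(1) vT] using u v fst_f by (simp add: prod_eq_iff)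
  qed
qed

section \<open>Pulled-back connection and solder form\<close>

lemma pull_form_eqI:
  assumes "\<kappa> (shadow F X) (snd (base_tangent B ambient F (proj B X, U))) = eucl_vec (f u)" "u \<in> T"
  shows "pull_form B F \<kappa> X U = u"
proof -
  have inj: "inj_on (\<lambda>u. snd (F (X, u))) T"
    by (rule inj_onI, rule inj_onD[OF f_inj]) (simp_all add: f_def)
  have "\<kappa> (shadow F X) (snd (base_tangent B ambient F (proj B X, U))) = snd (F (X, u))"
    using assms(1) F_eq[OF assms(2)] by simp
  then show ?thesis
    using inv_into_f_f[OF inj assms(2)] by (simp add: pull_form_def)
qed

lemma dproj_eqI:
  assumes "u \<in> T" "U \<in> Tb" "fst (f u) = fb U"
  shows "dproj u = U"
  by (rule inj_onD[OF fb_inj _ dproj_in_Tb assms(2)]) (use fst_f assms in simp)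

lemma pull_connection_facts:
  assumes "U \<in> Tb"
  shows "pull_connection B F X U \<in> T" "f (pull_connection B F X U) = (fb U, 0)"
proof -
  obtain u where u: "u \<in> T" "f u = (fb U, 0)" by (rule f_onto[OF assms])
  have "pull_connection B F X U = u"
    unfolding pull_connection_def
    by (rule pull_form_eqI) (simp_all add: space_connection_def fb_def u)
  with u show "pull_connection B F X U \<in> T" "f (pull_connection B F X U) = (fb U, 0)"
    by simp_all
qed

text \<open>The target \<open>(0, fb U)\<close> already has a vertical preimage, and injectivity of
  \<open>f\<close> makes it the only one; hence \<Theta> is vertical.\<close>

lemma pull_solder_facts:
  shows "pull_solder B F X U \<in> V" "f (pull_solder B F X U) = (0, fb U)"
proof -
  obtain u where u: "u \<in> V" "f u = (0, fb U)" by (rule f_vertical_onto)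
  then have "u \<in> T" by (simp add: vertical_iff)
  have "pull_solder B F X U = u"
    unfolding pull_solder_def
    by (rule pull_form_eqI) (simp_all add: space_solder_def fb_def u \<open>u \<in> T\<close>)
  with u show "pull_solder B F X U \<in> V" "f (pull_solder B F X U) = (0, fb U)"
    by simp_all
qed

lemma pull_solder_in_T: "pull_solder B F X U \<in> T"
  using pull_solder_facts(1) by (simp add: vertical_iff)

section \<open>The kernel of the pulled-back pseudo-metric\<close>

definition defect :: "('b, 'm) tvec \<Rightarrow> ('a, 'm \<times> 'f) tvec" where
  "defect U = (\<lambda>c. pull_connection B F X U c - pull_solder B F X U c)"

text \<open>The solder part is vertical, so subtracting it from \<Gamma> leaves a right inverse of
  the projection, that is, a connection. Its two image components are opposite and cancel under
  \<open>iota\<close>.\<close>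

lemma defect_facts:
  assumes "U \<in> Tb"
  shows "defect U \<in> T" "f (defect U) = (fb U, - fb U)" "dproj (defect U) = U"
proof -
  note \<Gamma> = pull_connection_facts[OF assms]
  have eq: "defect U =
      (\<lambda>c. 1 *\<^sub>R pull_connection B F X U c + (- 1) *\<^sub>R pull_solder B F X U c)"
    by (simp add: defect_def)
  show T: "defect U \<in> T"
    unfolding eq by (rule total.tangent_space_combination[OF \<Gamma>(1) pull_solder_in_T])
  show f: "f (defect U) = (fb U, - fb U)"
    unfolding eq f_combination[OF \<Gamma>(1) pull_solder_in_T] \<Gamma>(2) pull_solder_facts(2) by simp
  show "dproj (defect U) = U"
    by (rule dproj_eqI[OF T assms]) (simp add: f)
qed

text \<open>This is the vector part of \<open>iota\<close> after \<open>F\<close>, through which the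
  pseudo-metric factors.\<close>

definition stretch :: "('a, 'm \<times> 'f) tvec \<Rightarrow> space" where
  "stretch u = fst (f u) + snd (f u)"

lemma pull_pseudo_metric_eq:
  "u \<in> T \<Longrightarrow> w \<in> T \<Longrightarrow> pull_pseudo_metric F X u w = stretch u \<bullet> stretch w"
  by (cases "shadow F X")
    (simp add: pull_pseudo_metric_def space_pseudo_metric_def space_metric_def F_eq iota_def
      eucl_vec_def stretch_def)

lemma pull_base_metric_eq:
  "pull_base_metric B F (proj B X) U W = fb U \<bullet> fb W"
  by (simp add: pull_base_metric_def space_metric_def fb_def)

lemma solder_isometric:
  "pull_base_metric B F (proj B X) U W =
    pull_pseudo_metric F X (pull_solder B F X U) (pull_solder B F X W)"
  by (simp add: pull_base_metric_eq pull_pseudo_metric_eq pull_solder_in_T stretch_def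
      pull_solder_facts(2))

text \<open>The null directions of the pulled-back pseudo-metric are the horizontal directions of
  \<open>\<Gamma> - \<Theta>\<close>.\<close>

lemma null_iff:
  assumes "u \<in> T"
  shows "pull_pseudo_metric F X u u = 0 \<longleftrightarrow> u = defect (dproj u)"
proof -
  note d = defect_facts[OF dproj_in_Tb, of u]
  have "pull_pseudo_metric F X u u = 0 \<longleftrightarrow> fst (f u) + snd (f u) = 0"
    using assms by (simp add: pull_pseudo_metric_eq stretch_def)
  \<comment> \<open>Both images have first component \<open>fb (dproj u)\<close>, so the vanishing
    of the sum fixes the second one.\<close>
  also have "\<dots> \<longleftrightarrow> f u = f (defect (dproj u))"
    unfolding d(2) prod_eq_iff using fst_f[OF assms] by (simp add: add_eq_0_iff)
  also have "\<dots> \<longleftrightarrow> u = defect (dproj u)"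
    using inj_on_eq_iff[OF f_inj assms d(1)] .
  finally show ?thesis .
qed

text \<open>Subtracting the defect removes the projection and leaves \<open>stretch\<close>
  unchanged, since \<open>stretch\<close> vanishes on defects. This is how \<Gamma> - \<Theta> and
  the micro-metric rebuild the whole pseudo-metric.\<close>

lemma pull_pseudo_metric_vertical_part:
  assumes "u \<in> T" "w \<in> T"
  defines "vert \<equiv> \<lambda>u c. u c - defect (dproj u) c"
  shows "vert u \<in> V"
    and "pull_pseudo_metric F X u w = pull_pseudo_metric F X (vert u) (vert w)"
proof -
  have vert: "vert u \<in> V" "stretch (vert u) = stretch u" if u: "u \<in> T" for u
  proof -
    note d = defect_facts[OF dproj_in_Tb, of u]
    have eq: "vert u = (\<lambda>c. 1 *\<^sub>R u c + (- 1) *\<^sub>R defect (dproj u) c)"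
      by (simp add: vert_def)
    have "dproj (vert u) = (\<lambda>_. 0)"
      unfolding eq dproj_combination d(3) by simp
    moreover have "vert u \<in> T"
      unfolding eq by (rule total.tangent_space_combination[OF u d(1)])
    ultimately show "vert u \<in> V" by (simp add: vertical_iff)
    show "stretch (vert u) = stretch u"
      unfolding stretch_def eq f_combination[OF u d(1)] d(2) by simp
  qed
  show "vert u \<in> V" by (rule vert(1)[OF assms(1)])
  have "vert u \<in> T" "vert w \<in> T"
    using vert(1)[OF assms(1)] vert(1)[OF assms(2)] by (simp_all add: vertical_iff)
  then show "pull_pseudo_metric F X u w = pull_pseudo_metric F X (vert u) (vert w)"
    using assms(1,2) vert(2) by (simp add: pull_pseudo_metric_eq)
qed

text \<open>With equal dimensions the injective linear \<open>fb\<close> reaches all of space, in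
  particular the second component of \<open>f v\<close>. Both \<open>v\<close> and the corresponding
  value of \<Theta> have first component zero, so injectivity of \<open>f\<close> identifies
  them.\<close>

lemma pull_solder_onto:
  assumes "DIM('m) = DIM('f)" "v \<in> V"
  obtains U where "U \<in> Tb" "v = pull_solder B F X U"
proof -
  obtain b :: "'m \<Rightarrow> ('b, 'm) tvec" where b: "\<And>z. b z \<in> Tb"
    "\<And>z w r s. b (r *\<^sub>R z + s *\<^sub>R w) = (\<lambda>d. r *\<^sub>R b z d + s *\<^sub>R b w d)" "inj b"
    by (rule base_coordinates) blast
  have "fb (b (r *\<^sub>R z + s *\<^sub>R w)) = r *\<^sub>R fb (b z) + s *\<^sub>R fb (b w)" for r s z w
    by (simp only: b(2) fb_combination)
  from this[of 1 _ 1] this[of _ _ 0] have "linear (\<lambda>z. fb (b z))"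
    by (intro linearI) simp_all
  moreover have "inj (\<lambda>z. fb (b z))"
  proof (rule injI)
    fix z z' assume "fb (b z) = fb (b z')"
    then have "b z = b z'" by (rule inj_onD[OF fb_inj _ b(1) b(1)])
    then show "z = z'" by (rule injD[OF b(3)])
  qed
  ultimately have "surj (\<lambda>z. fb (b z))"
    using assms(1) rank by (intro linear_inj_imp_surj_DIM) auto
  then obtain z where z: "snd (f v) = fb (b z)" by (rule surjE)
  have vT: "v \<in> T" and "dproj v = (\<lambda>_. 0)"
    using assms(2) by (simp_all add: vertical_iff)
  then have "f v = f (pull_solder B F X (b z))"
    using z fst_f[OF vT] fb_zero by (simp add: prod_eq_iff pull_solder_facts(2))
  then have "v = pull_solder B F X (b z)"
    by (rule inj_onD[OF f_inj _ vT pull_solder_in_T])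
  with b(1) show thesis by (rule that)
qed

end

section \<open>Comparison of the data of two placements\<close>

theorem mainTheorem4:
  fixes k :: enat
    and B :: "('a, 'b, 'm::euclidean_space, 'f::euclidean_space) fibration"
  assumes "1 \<le> k"
    and "affine_bundle (k + 1) B"
    and "DIM('f) = 3"
    and "DIM('m) \<in> {1, 2, 3}"
  shows
    "(\<forall>F\<in>Conf k B ambient. \<forall>F'\<in>Conf k B ambient.
        same_pseudo_metric B F F' \<longleftrightarrow>
          same_micro_metric B F F' \<and> same_difference B F F') \<and>
     (\<forall>F\<in>Conf k B ambient. \<forall>X\<in>points (total B).
        \<forall>U\<in>tangent_space (base B) (proj B X). \<forall>W\<in>tangent_space (base B) (proj B X).
        pull_base_metric B F (proj B X) U W =
          pull_pseudo_metric F X (pull_solder B F X U) (pull_solder B F X W)) \<and>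
     (DIM('m) = DIM('f) \<longrightarrow>
        (\<forall>F\<in>Conf k B ambient. \<forall>F'\<in>Conf k B ambient.
           same_solder B F F' \<longrightarrow>
             (same_micro_metric B F F' \<longleftrightarrow> same_base_metric B F F')))"
proof (intro conjI ballI impI)
  have placed: "placed_point k B X F" if "F \<in> Conf k B ambient" "X \<in> points (total B)" for F X
    using assms that by (simp add: placed_point_def placed_point_axioms_def material_point_def)
  show "pull_base_metric B F (proj B X) U W =
      pull_pseudo_metric F X (pull_solder B F X U) (pull_solder B F X W)"
    if F: "F \<in> Conf k B ambient" and X: "X \<in> points (total B)" for F X U W
    by (rule placed_point.solder_isometric[OF placed[OF F X]])
  show "same_pseudo_metric B F F' \<longleftrightarrow> same_micro_metric B F F' \<and> same_difference B F F'"
    if F: "F \<in> Conf k B ambient" and F': "F' \<in> Conf k B ambient" for F F'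
  proof
    assume same: "same_pseudo_metric B F F'"
    then have "same_micro_metric B F F'"
      by (simp add: same_pseudo_metric_def same_micro_metric_def vertical_def)
    moreover have "same_difference B F F'"
      unfolding same_difference_def
    proof (intro ballI allI)
      fix X U c assume X: "X \<in> points (total B)" and U: "U \<in> tangent_space (base B) (proj B X)"
      interpret F: placed_point k B X F by (rule placed[OF F X])
      interpret F': placed_point k B X F' by (rule placed[OF F' X])
      note d = F.defect_facts[OF U]
      \<comment> \<open>The defect of \<open>F\<close> is null for \<open>F\<close>, hence for
        \<open>F'\<close>. By \<open>null_iff\<close> for \<open>F'\<close> it is then the
        \<open>F'\<close> defect of its own projection, which is \<open>U\<close>.\<close>
      have "pull_pseudo_metric F X (F.defect U) (F.defect U) = 0"
        unfolding F.null_iff[OF d(1)] d(3) ..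
      then have "pull_pseudo_metric F' X (F.defect U) (F.defect U) = 0"
        using same X d(1) by (simp add: same_pseudo_metric_def)
      then have "F.defect U = F'.defect U"
        unfolding F'.null_iff[OF d(1)] d(3) .
      then show "pull_connection B F X U c - pull_solder B F X U c =
          pull_connection B F' X U c - pull_solder B F' X U c"
        unfolding F.defect_def F'.defect_def by (rule fun_cong)
    qed
    ultimately show "same_micro_metric B F F' \<and> same_difference B F F'" ..
  next
    assume same: "same_micro_metric B F F' \<and> same_difference B F F'"
    show "same_pseudo_metric B F F'"
      unfolding same_pseudo_metric_def
    proof (intro ballI)
      fix X U W assume X: "X \<in> points (total B)"
        and U: "U \<in> tangent_space (total B) X" and W: "W \<in> tangent_space (total B) X"
      interpret F: placed_point k B X F by (rule placed[OF F X])
      interpret F': placed_point k B X F' by (rule placed[OF F' X])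
      \<comment> \<open>The projection depends on the bundle alone, so both placements subtract the
        same vector to reach the vertical part.\<close>
      have defect: "F'.defect (F.dproj u) = F.defect (F.dproj u)" for u
      proof
        fix c
        show "F'.defect (F.dproj u) c = F.defect (F.dproj u) c"
          unfolding F.defect_def F'.defect_def
          using same X F.dproj_in_Tb[of u] unfolding same_difference_def by metis
      qed
      show "pull_pseudo_metric F X U W = pull_pseudo_metric F' X U W"
        unfolding F.pull_pseudo_metric_vertical_part(2)[OF U W]
          F'.pull_pseudo_metric_vertical_part(2)[OF U W] defect
        using same X F.pull_pseudo_metric_vertical_part(1)[OF U U]
          F.pull_pseudo_metric_vertical_part(1)[OF W W]
        by (simp add: same_micro_metric_def)
    qed
  qed
  show "same_micro_metric B F F' \<longleftrightarrow> same_base_metric B F F'"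
    if dim: "DIM('m) = DIM('f)" and F: "F \<in> Conf k B ambient" and F': "F' \<in> Conf k B ambient"
      and solder: "same_solder B F F'" for F F'
  proof
    assume micro: "same_micro_metric B F F'"
    show "same_base_metric B F F'"
      unfolding same_base_metric_def
    proof (intro ballI)
      fix x U W assume x: "x \<in> points (base B)"
        and U: "U \<in> tangent_space (base B) x" and W: "W \<in> tangent_space (base B) x"
      \<comment> \<open>The isometry is stated at points of the total space; surjectivity of the
        projection supplies one above \<open>x\<close>.\<close>
      have "x \<in> proj B ` points (total B)"
        using x assms(2) by (simp add: affine_bundle_def)
      then obtain X where x_eq: "x = proj B X" and X: "X \<in> points (total B)" by (rule imageE)
      interpret F: placed_point k B X F by (rule placed[OF F X])
      interpret F': placed_point k B X F' by (rule placed[OF F' X])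
      have "pull_solder B F' X U = pull_solder B F X U" "pull_solder B F' X W = pull_solder B F X W"
        using solder X U W by (simp_all add: same_solder_def x_eq)
      then show "pull_base_metric B F x U W = pull_base_metric B F' x U W"
        using micro X F.pull_solder_facts(1)
        by (simp add: same_micro_metric_def x_eq F.solder_isometric F'.solder_isometric)
    qed
  next
    assume base: "same_base_metric B F F'"
    show "same_micro_metric B F F'"
      unfolding same_micro_metric_def
    proof (intro ballI)
      fix X u w assume X: "X \<in> points (total B)"
        and u: "u \<in> vertical B X" and w: "w \<in> vertical B X"
      interpret F: placed_point k B X F by (rule placed[OF F X])
      interpret F': placed_point k B X F' by (rule placed[OF F' X])
      \<comment> \<open>The equal dimensions enter here: each vertical vector is a value of
        \<Theta>, and since the solder forms agree, the same base vector represents it for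
        \<open>F'\<close>.\<close>
      obtain U where U: "U \<in> F.Tb" "u = pull_solder B F X U"
        by (rule F.pull_solder_onto[OF dim u])
      obtain W where W: "W \<in> F.Tb" "w = pull_solder B F X W"
        by (rule F.pull_solder_onto[OF dim w])
      have "u = pull_solder B F' X U" "w = pull_solder B F' X W"
        using solder X U W by (simp_all add: same_solder_def)
      then have "pull_pseudo_metric F' X u w = pull_base_metric B F' (proj B X) U W"
        by (simp add: F'.solder_isometric)
      moreover have "pull_pseudo_metric F X u w = pull_base_metric B F (proj B X) U W"
        using U(2) W(2) by (simp add: F.solder_isometric)
      ultimately show "pull_pseudo_metric F X u w = pull_pseudo_metric F' X u w"
        using base U(1) W(1) F.proj_X by (simp add: same_base_metric_def)
    qed
  qed
qed

end
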